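(* Let $h_1\ge\dots\ge h_n>0$ be integers with $n\ge2$, $N=h_1+\dots+h_n$, and $h_1=N/2$. Then a $\mathrm{LC}(h_1h_2\dots h_n)$ exists if and only if a $\mathrm{LC}(h_2\dots h_n)$ exists.
   Context: A latin cube of order $M$ is an $M\times M\times M$ array on $M$ symbols such that any two cells whose coordinates differ in exactly one position contain different symbols; a subcube is an $m\times m\times m$ subarray (indices in each coordinate from chosen $m$-sets) that is itself a latin cube of order $m$; subcubes are disjoint if they share no index in any coordinate and no symbol. For positive integers $k_1\ge\dots\ge k_r$, a $\mathrm{LC}(k_1\dots k_r)$ is a latin cube of order $\sum k_i$ with pairwise disjoint subcubes of orders $k_1,\dots,k_r$. *)

theory Defs
  imports Main
begin

type_synonym cell = "nat \<times> nat \<times> nat"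

fun differ_in_one :: "cell \<Rightarrow> cell \<Rightarrow> bool" where
  "differ_in_one (i, j, k) (i', j', k') \<longleftrightarrow>
     (i \<noteq> i' \<and> j = j' \<and> k = k') \<or>
     (i = i' \<and> j \<noteq> j' \<and> k = k') \<or>
     (i = i' \<and> j = j' \<and> k \<noteq> k')"

text \<open>
  Arrays are total functions on cells; only the values on \<open>I \<times> J \<times> K\<close> matter. The index sets are
  explicit so that the same notion applies to a full cube and to its subarrays.
\<close>

definition latin_cube_on ::
  "nat \<Rightarrow> nat set \<Rightarrow> nat set \<Rightarrow> nat set \<Rightarrow> nat set \<Rightarrow> (cell \<Rightarrow> nat) \<Rightarrow> bool" where
  "latin_cube_on m I J K S L \<longleftrightarrow>
     finite I \<and> card I = m \<and> finite J \<and> card J = m \<and> finite K \<and> card K = m \<and>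
     finite S \<and> card S = m \<and>
     (\<forall>p \<in> I \<times> J \<times> K. L p \<in> S) \<and>
     (\<forall>p \<in> I \<times> J \<times> K. \<forall>q \<in> I \<times> J \<times> K. differ_in_one p q \<longrightarrow> L p \<noteq> L q)"

definition latin_cube :: "nat \<Rightarrow> (cell \<Rightarrow> nat) \<Rightarrow> bool" where
  "latin_cube M L \<longleftrightarrow> latin_cube_on M {..<M} {..<M} {..<M} {..<M} L"

definition subcube ::
  "nat \<Rightarrow> (cell \<Rightarrow> nat) \<Rightarrow> nat \<Rightarrow> nat set \<Rightarrow> nat set \<Rightarrow> nat set \<Rightarrow> nat set \<Rightarrow> bool" where
  "subcube M L m I J K S \<longleftrightarrow>
     I \<subseteq> {..<M} \<and> J \<subseteq> {..<M} \<and> K \<subseteq> {..<M} \<and> S \<subseteq> {..<M} \<and> latin_cube_on m I J K S L"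

text \<open>
  \<open>LC ks L\<close>: the array \<open>L\<close> is an \<open>LC(k\<^sub>1\<dots>k\<^sub>r)\<close>, where \<open>ks\<close> lists \<open>k\<^sub>1, \<dots>, k\<^sub>r\<close>. It is meant for
  weakly decreasing lists of positive integers.
\<close>

definition LC :: "nat list \<Rightarrow> (cell \<Rightarrow> nat) \<Rightarrow> bool" where
  "LC ks L \<longleftrightarrow>
     latin_cube (sum_list ks) L \<and>
     (\<exists>I J K S :: nat \<Rightarrow> nat set.
        (\<forall>t < length ks. subcube (sum_list ks) L (ks ! t) (I t) (J t) (K t) (S t)) \<and>
        (\<forall>s < length ks. \<forall>t < length ks. s \<noteq> t \<longrightarrow>
           I s \<inter> I t = {} \<and> J s \<inter> J t = {} \<and> K s \<inter> K t = {} \<and> S s \<inter> S t = {}))"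

end

(* Let h = N/2. Split each index set and the symbol set into the part (0) used by the subcube of
   order h and its complement (1), also of size h. Every line is a permutation of the symbols, so a
   line meeting the block 000 carries the symbols of part 1 outside it; propagating this to the
   other blocks, the block abc carries exactly the symbols of part a + b + c mod 2. Hence the block
   111 is a latin cube of order h, and it contains all the other subcubes. Conversely, filling each
   block abc with a copy of a given latin cube of order h on the symbols of part a + b + c mod 2
   gives a latin cube of order 2h. *)
theory Submission
  imports Defs
begin

section \<open>Latin cubes line by line, and relabelling\<close>

text \<open>Cells differing in one coordinate share an axis-parallel line; splitting by direction
  gives the injectivity form that counting along lines needs.\<close>

lemma latin_cube_on_iff:
  "latin_cube_on m I J K S L \<longleftrightarrow>
     finite I \<and> card I = m \<and> finite J \<and> card J = m \<and> finite K \<and> card K = m \<and>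
     finite S \<and> card S = m \<and>
     (\<forall>i\<in>I. \<forall>j\<in>J. \<forall>k\<in>K. L (i, j, k) \<in> S) \<and>
     (\<forall>j\<in>J. \<forall>k\<in>K. inj_on (\<lambda>i. L (i, j, k)) I) \<and>
     (\<forall>i\<in>I. \<forall>k\<in>K. inj_on (\<lambda>j. L (i, j, k)) J) \<and>
     (\<forall>i\<in>I. \<forall>j\<in>J. inj_on (\<lambda>k. L (i, j, k)) K)"
proof -
  have "(\<forall>p \<in> I \<times> J \<times> K. \<forall>q \<in> I \<times> J \<times> K. differ_in_one p q \<longrightarrow> L p \<noteq> L q) \<longleftrightarrow>
     (\<forall>j\<in>J. \<forall>k\<in>K. inj_on (\<lambda>i. L (i, j, k)) I) \<and>
     (\<forall>i\<in>I. \<forall>k\<in>K. inj_on (\<lambda>j. L (i, j, k)) J) \<and>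
     (\<forall>i\<in>I. \<forall>j\<in>J. inj_on (\<lambda>k. L (i, j, k)) K)" (is "?L \<longleftrightarrow> ?R")
  proof
    assume ?L
    then have "differ_in_one (i, j, k) (i', j', k') \<longrightarrow> L (i, j, k) \<noteq> L (i', j', k')"
      if "i \<in> I" "j \<in> J" "k \<in> K" "i' \<in> I" "j' \<in> J" "k' \<in> K" for i j k i' j' k'
      using that by blast
    then show ?R
      unfolding inj_on_def differ_in_one.simps by blast
  next
    assume ?R
    then show ?L
      by (auto simp: inj_on_def)
  qed
  then show ?thesis
    by (simp add: latin_cube_on_def)
qed

text \<open>Bijections on indices and symbols preserve injectivity on lines. The index maps go from
  new to old and the symbol map from old to new, so \<open>L'\<close> is a composition; it is
  constrained only on the new box, since other values are irrelevant.\<close>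

lemma latin_cube_on_relabel:
  assumes L: "latin_cube_on m I J K S L"
    and I: "bij_betw a I' I" and J: "bij_betw b J' J" and K: "bij_betw c K' K"
    and S: "bij_betw s S S'"
    and L': "\<And>i j k. i \<in> I' \<Longrightarrow> j \<in> J' \<Longrightarrow> k \<in> K' \<Longrightarrow> L' (i, j, k) = s (L (a i, b j, c k))"
  shows "latin_cube_on m I' J' K' S' L'"
proof -
  have mem: "a i \<in> I" "b j \<in> J" "c k \<in> K" if "i \<in> I'" "j \<in> J'" "k \<in> K'" for i j k
    using I J K that by (auto dest: bij_betwE)
  have val: "L (i, j, k) \<in> S" if "i \<in> I" "j \<in> J" "k \<in> K" for i j k
    using L that by (auto simp: latin_cube_on_iff)
  have s: "s x = s y \<longleftrightarrow> x = y" if "x \<in> S" "y \<in> S" for x y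
    using S that by (auto simp: bij_betw_def inj_on_def)
  have eq: "L' (i, j, k) = L' (i', j', k') \<longleftrightarrow> L (a i, b j, c k) = L (a i', b j', c k')"
    if "i \<in> I'" "j \<in> J'" "k \<in> K'" "i' \<in> I'" "j' \<in> J'" "k' \<in> K'" for i j k i' j' k'
    using that by (simp add: L' s val mem)
  have abc: "inj_on a I'" "inj_on b J'" "inj_on c K'"
    using I J K by (auto simp: bij_betw_def)
  have "inj_on (\<lambda>i. L' (i, j, k)) I'" if "j \<in> J'" "k \<in> K'" for j k
  proof (rule inj_onI)
    fix x y assume xy: "x \<in> I'" "y \<in> I'" "L' (x, j, k) = L' (y, j, k)"
    then have "L (a x, b j, c k) = L (a y, b j, c k)" using eq that by blast
    then have "a x = a y" using L mem[OF xy(1) that] mem[OF xy(2) that]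
      unfolding latin_cube_on_iff inj_on_def by blast
    then show "x = y" using abc xy by (auto dest: inj_onD)
  qed
  moreover have "inj_on (\<lambda>j. L' (i, j, k)) J'" if "i \<in> I'" "k \<in> K'" for i k
  proof (rule inj_onI)
    fix x y assume xy: "x \<in> J'" "y \<in> J'" "L' (i, x, k) = L' (i, y, k)"
    then have "L (a i, b x, c k) = L (a i, b y, c k)" using eq that by blast
    then have "b x = b y" using L mem[OF that(1) xy(1) that(2)] mem[OF that(1) xy(2) that(2)]
      unfolding latin_cube_on_iff inj_on_def by blast
    then show "x = y" using abc xy by (auto dest: inj_onD)
  qed
  moreover have "inj_on (\<lambda>k. L' (i, j, k)) K'" if "i \<in> I'" "j \<in> J'" for i j
  proof (rule inj_onI)
    fix x y assume xy: "x \<in> K'" "y \<in> K'" "L' (i, j, x) = L' (i, j, y)"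
    then have "L (a i, b j, c x) = L (a i, b j, c y)" using eq that by blast
    then have "c x = c y" using L mem[OF that xy(1)] mem[OF that xy(2)]
      unfolding latin_cube_on_iff inj_on_def by blast
    then show "x = y" using abc xy by (auto dest: inj_onD)
  qed
  moreover have "L' (i, j, k) \<in> S'" if "i \<in> I'" "j \<in> J'" "k \<in> K'" for i j k
    using that S val[OF mem[OF that]] by (auto simp: L' dest: bij_betwE)
  moreover have "finite I'" "finite J'" "finite K'" "finite S'"
    "card I' = m" "card J' = m" "card K' = m" "card S' = m"
    using L bij_betw_finite[OF I] bij_betw_finite[OF J] bij_betw_finite[OF K]
      bij_betw_finite[OF S] bij_betw_same_card[OF I] bij_betw_same_card[OF J]
      bij_betw_same_card[OF K] bij_betw_same_card[OF S]
    by (auto simp: latin_cube_on_iff)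
  ultimately show ?thesis
    unfolding latin_cube_on_iff by blast
qed

section \<open>The complement of a subcube of half the order\<close>

text \<open>Pigeonhole: by cardinality \<open>B\<close> already takes every value in
  \<open>T\<close>, so injectivity leaves none of them for a point outside \<open>B\<close>.\<close>

lemma inj_on_notin_saturated:
  assumes "inj_on f A" "B \<subseteq> A" "f ` B \<subseteq> T" "finite T" "card B = card T" "x \<in> A - B"
  shows "f x \<notin> T"
proof -
  have "card (f ` B) = card T"
    using assms by (metis card_image inj_on_subset)
  then have "f ` B = T"
    using assms card_subset_eq by blast
  then show ?thesis
    using assms by (auto dest: inj_onD)
qed

lemma latin_cube_on_complement_half:
  assumes L: "latin_cube (2 * h) L" and sub: "subcube (2 * h) L h I J K S"
  shows "latin_cube_on h ({..<2*h} - I) ({..<2*h} - J) ({..<2*h} - K) ({..<2*h} - S) L"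
proof -
  define A where "A = {..<2*h}"
  have val: "L (i, j, k) \<in> A" if "i \<in> A" "j \<in> A" "k \<in> A" for i j k
    using L that by (auto simp: latin_cube_def latin_cube_on_iff A_def)
  have injI: "inj_on (\<lambda>i. L (i, j, k)) A" if "j \<in> A" "k \<in> A" for j k
    using L that by (auto simp: latin_cube_def latin_cube_on_iff A_def)
  have injJ: "inj_on (\<lambda>j. L (i, j, k)) A" if "i \<in> A" "k \<in> A" for i k
    using L that by (auto simp: latin_cube_def latin_cube_on_iff A_def)
  have injK: "inj_on (\<lambda>k. L (i, j, k)) A" if "i \<in> A" "j \<in> A" for i j
    using L that by (auto simp: latin_cube_def latin_cube_on_iff A_def)
  have sub': "I \<subseteq> A" "J \<subseteq> A" "K \<subseteq> A" "S \<subseteq> A" "finite I" "finite J" "finite K" "finite S"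
    "card I = h" "card J = h" "card K = h" "card S = h"
    and v000: "\<And>i j k. i \<in> I \<Longrightarrow> j \<in> J \<Longrightarrow> k \<in> K \<Longrightarrow> L (i, j, k) \<in> S"
    using sub by (auto simp: subcube_def latin_cube_on_iff A_def)
  have finA: "finite A" by (simp add: A_def)
  \<comment> \<open>Half the order is essential here: a part and its complement have equal size, so
    half a line can exhaust either half of the symbols.\<close>
  have compl: "card (A - X) = h" if "X \<subseteq> A" "card X = h" for X
    using that by (auto simp: A_def card_Diff_subset finite_subset)
  \<comment> \<open>In these names a digit is 0 for a coordinate inside the subcube's index set and
    1 for one outside. A line through block 000 uses up \<open>S\<close> there.\<close>
  have v001: "L (i, j, k) \<in> A - S" if "i \<in> I" "j \<in> J" "k \<in> A - K" for i j k
  proof -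
    have "L (i, j, k) \<notin> S"
      by (rule inj_on_notin_saturated[OF injK, of i j K S k])
        (use that sub' v000 in auto)
    then show ?thesis using val[of i j k] that sub' by auto
  qed
  have v010: "L (i, j, k) \<in> A - S" if "i \<in> I" "j \<in> A - J" "k \<in> K" for i j k
  proof -
    have "L (i, j, k) \<notin> S"
      by (rule inj_on_notin_saturated[OF injJ, of i k J S j])
        (use that sub' v000 in auto)
    then show ?thesis using val[of i j k] that sub' by auto
  qed
  have v100: "L (i, j, k) \<in> A - S" if "i \<in> A - I" "j \<in> J" "k \<in> K" for i j k
  proof -
    have "L (i, j, k) \<notin> S"
      by (rule inj_on_notin_saturated[OF injI, of j k I S i])
        (use that sub' v000 in auto)
    then show ?thesis using val[of i j k] that sub' by auto
  qed
  \<comment> \<open>Along the third axis, block 010 has exhausted \<open>A - S\<close>.\<close>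
  have v011: "L (i, j, k) \<in> S" if "i \<in> I" "j \<in> A - J" "k \<in> A - K" for i j k
  proof -
    have "L (i, j, k) \<notin> A - S"
      by (rule inj_on_notin_saturated[OF injK, of i j K "A - S" k])
        (use that sub' v010 finA compl in auto)
    then show ?thesis using val[of i j k] that sub' by auto
  qed
  \<comment> \<open>Along the first axis, block 011 has exhausted \<open>S\<close>.\<close>
  have v111: "L (i, j, k) \<in> A - S" if "i \<in> A - I" "j \<in> A - J" "k \<in> A - K" for i j k
  proof -
    have "L (i, j, k) \<notin> S"
      by (rule inj_on_notin_saturated[OF injI, of j k I S i])
        (use that sub' v011 finA compl in auto)
    then show ?thesis using val[of i j k] that by auto
  qed
  show ?thesis
    unfolding A_def[symmetric] latin_cube_on_iff
    using finA compl sub' v111 injI injJ injK by (auto intro: inj_on_diff)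
qed

section \<open>Removing the large subcube\<close>

lemma LCI:
  assumes "latin_cube (sum_list ks) L"
    and "\<And>t. t < length ks \<Longrightarrow> subcube (sum_list ks) L (ks ! t) (I t) (J t) (K t) (S t)"
    and "\<And>s t. s < length ks \<Longrightarrow> t < length ks \<Longrightarrow> s \<noteq> t \<Longrightarrow>
        I s \<inter> I t = {} \<and> J s \<inter> J t = {} \<and> K s \<inter> K t = {} \<and> S s \<inter> S t = {}"
  shows "LC ks L"
  using assms unfolding LC_def by blast

text \<open>Disjointness from the first subcube puts all others inside the complementary cube, which
  is then relabelled to the standard index and symbol set \<open>{..<h}\<close>.\<close>

lemma LC_tl_if_LC:
  assumes LC: "LC (h # ks) L" and h: "sum_list ks = h"
  shows "\<exists>L'. LC ks L'"
proof -
  define A where "A = {..<2*h}"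
  have sum: "sum_list (h # ks) = 2 * h" using h by simp
  obtain I J K S where L: "latin_cube (2 * h) L"
    and sub: "\<And>t. t < Suc (length ks) \<Longrightarrow>
        subcube (2 * h) L ((h # ks) ! t) (I t) (J t) (K t) (S t)"
    and disj: "\<And>s t. s < Suc (length ks) \<Longrightarrow> t < Suc (length ks) \<Longrightarrow> s \<noteq> t \<Longrightarrow>
        I s \<inter> I t = {} \<and> J s \<inter> J t = {} \<and> K s \<inter> K t = {} \<and> S s \<inter> S t = {}"
    using LC unfolding LC_def sum length_Cons by metis
  define I1 J1 K1 S1 where "I1 = A - I 0" "J1 = A - J 0" "K1 = A - K 0" "S1 = A - S 0"
  have cube: "latin_cube_on h I1 J1 K1 S1 L"
    using latin_cube_on_complement_half[OF L, of "I 0" "J 0" "K 0" "S 0"] sub[of 0]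
    by (simp add: I1_J1_K1_S1_def A_def)
  then have "card {..<h} = card I1" "card {..<h} = card J1" "card {..<h} = card K1"
    "card S1 = card {..<h}" "finite I1" "finite J1" "finite K1" "finite S1"
    by (auto simp: latin_cube_on_iff)
  then obtain a b c s where bij: "bij_betw a {..<h} I1" "bij_betw b {..<h} J1"
      "bij_betw c {..<h} K1" "bij_betw s S1 {..<h}"
    by (metis finite_lessThan finite_same_card_bij)
  define L' where "L' = (\<lambda>(i, j, k). s (L (a i, b j, c k)))"
  \<comment> \<open>Preimages are cut down to \<open>{..<h}\<close> because the bijections are total
    functions with unknown values elsewhere.\<close>
  define pull where "pull g X = {x \<in> {..<h}. g x \<in> X}" for g :: "nat \<Rightarrow> nat" and X
  have pull: "bij_betw g (pull g X) X" if "bij_betw g {..<h} Y" "X \<subseteq> Y" for g X Y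
    using that by (auto simp: bij_betw_def pull_def inj_on_def)
  have cube': "latin_cube h L'"
    unfolding latin_cube_def
    by (rule latin_cube_on_relabel[OF cube bij]) (simp add: L'_def)
  have in1: "I (Suc t) \<subseteq> I1" "J (Suc t) \<subseteq> J1" "K (Suc t) \<subseteq> K1" "S (Suc t) \<subseteq> S1"
    if "t < length ks" for t
    using sub[of "Suc t"] disj[of 0 "Suc t"] that
    by (auto simp: subcube_def I1_J1_K1_S1_def A_def)
  have sub': "subcube h L' (ks ! t) (pull a (I (Suc t))) (pull b (J (Suc t)))
      (pull c (K (Suc t))) (s ` S (Suc t))" if t: "t < length ks" for t
  proof -
    have cube_t: "latin_cube_on (ks ! t) (I (Suc t)) (J (Suc t)) (K (Suc t)) (S (Suc t)) L"
      using sub[of "Suc t"] t by (simp add: subcube_def)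
    have s_t: "bij_betw s (S (Suc t)) (s ` S (Suc t))"
      using bij(4) in1(4)[OF t] by (auto simp: bij_betw_def intro: inj_on_subset)
    have "latin_cube_on (ks ! t) (pull a (I (Suc t))) (pull b (J (Suc t)))
      (pull c (K (Suc t))) (s ` S (Suc t)) L'"
      by (rule latin_cube_on_relabel[OF cube_t pull[OF bij(1) in1(1)[OF t]]
            pull[OF bij(2) in1(2)[OF t]] pull[OF bij(3) in1(3)[OF t]] s_t])
        (simp add: L'_def)
    moreover have "s ` S (Suc t) \<subseteq> {..<h}"
      using bij_betw_imp_surj_on[OF bij(4)] image_mono[OF in1(4)[OF t], of s] by simp
    ultimately show ?thesis
      by (auto simp: subcube_def pull_def)
  qed
  have "pull a (I (Suc u)) \<inter> pull a (I (Suc t)) = {} \<and>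
      pull b (J (Suc u)) \<inter> pull b (J (Suc t)) = {} \<and>
      pull c (K (Suc u)) \<inter> pull c (K (Suc t)) = {} \<and>
      s ` S (Suc u) \<inter> s ` S (Suc t) = {}"
    if "u < length ks" "t < length ks" "u \<noteq> t" for u t
  proof -
    \<comment> \<open>Preimages of disjoint sets are always disjoint, but images of the symbol sets
      need injectivity of \<open>s\<close>, known on \<open>S1\<close>.\<close>
    have "inj_on s S1" using bij by (simp add: bij_betw_def)
    then have "s ` S (Suc u) \<inter> s ` S (Suc t) = s ` (S (Suc u) \<inter> S (Suc t))"
      using in1 that by (metis inj_on_image_Int)
    then show ?thesis
      using disj[of "Suc u" "Suc t"] that by (auto simp: pull_def)
  qed
  then have "LC ks L'"
    using cube' sub' unfolding h[symmetric]
    by (intro LCI[where I = "\<lambda>t. pull a (I (Suc t))" and J = "\<lambda>t. pull b (J (Suc t))"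
          and K = "\<lambda>t. pull c (K (Suc t))" and S = "\<lambda>t. s ` S (Suc t)"]) auto
  then show ?thesis by blast
qed

section \<open>Doubling a latin cube\<close>

text \<open>The direct product of \<open>L\<close> with the order 2 cube given by addition mod 2:
  the quotient by \<open>h\<close> is the block number, the remainder the position in the
  block.\<close>

definition doubled :: "nat \<Rightarrow> (cell \<Rightarrow> nat) \<Rightarrow> cell \<Rightarrow> nat" where
  "doubled h L = (\<lambda>(i, j, k). L (i mod h, j mod h, k mod h) +
     (if odd (i div h + j div h + k div h) then h else 0))"

text \<open>Here \<open>d\<close> is the sum of the block numbers of the two fixed coordinates.
  Since \<open>f\<close> stays below \<open>h\<close> on positions, a value reveals both the parity
  of the block and the value of \<open>f\<close>.\<close>

lemma inj_on_doubled_line: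
  fixes f :: "nat \<Rightarrow> nat"
  assumes inj: "inj_on f {..<h}" and f: "\<And>x. x < h \<Longrightarrow> f x < h"
  shows "inj_on (\<lambda>x. f (x mod h) + (if odd (x div h + d) then h else 0)) {..<2*h}"
proof (rule inj_onI)
  fix x y
  assume x: "x \<in> {..<2*h}" and y: "y \<in> {..<2*h}"
    and eq: "f (x mod h) + (if odd (x div h + d) then h else 0) =
      f (y mod h) + (if odd (y div h + d) then h else 0)"
  have h: "h > 0" using x by auto
  then have less: "f (x mod h) < h" "f (y mod h) < h" using f by auto
  \<comment> \<open>There are only the blocks 0 and 1, so parity determines the block
    number.\<close>
  have "x div h < 2" "y div h < 2" using x y h by (auto simp: less_mult_imp_div_less)
  moreover have "odd (x div h + d) \<longleftrightarrow> odd (y div h + d)"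
    using eq less by (auto split: if_splits)
  ultimately have "x div h = y div h"
    by (auto simp: less_2_cases_iff)
  moreover have "x mod h = y mod h"
    using eq less h inj by (auto split: if_splits dest: inj_onD)
  ultimately show "x = y"
    by (metis mult_div_mod_eq)
qed

lemma latin_cube_doubled:
  assumes L: "latin_cube h L"
  shows "latin_cube (2 * h) (doubled h L)"
proof (cases "h = 0")
  \<comment> \<open>For \<open>h = 0\<close> the array is empty; otherwise remainders mod
    \<open>h\<close> are valid indices of \<open>L\<close>.\<close>
  case True
  then show ?thesis by (simp add: latin_cube_def latin_cube_on_def)
next
  case False
  have val: "L (i, j, k) < h" if "i < h" "j < h" "k < h" for i j k
    using L that by (auto simp: latin_cube_def latin_cube_on_iff)
  have valm: "L (i mod h, j mod h, k mod h) < h" for i j k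
    using False by (simp add: val)
  have "inj_on (\<lambda>i. doubled h L (i, j, k)) {..<2*h}" for j k
    using inj_on_doubled_line[of "\<lambda>i. L (i, j mod h, k mod h)" h "j div h + k div h"] L False
    by (auto simp: doubled_def latin_cube_def latin_cube_on_iff ac_simps simp del: even_add odd_add)
  moreover have "inj_on (\<lambda>j. doubled h L (i, j, k)) {..<2*h}" for i k
    using inj_on_doubled_line[of "\<lambda>j. L (i mod h, j, k mod h)" h "i div h + k div h"] L False
    by (auto simp: doubled_def latin_cube_def latin_cube_on_iff ac_simps simp del: even_add odd_add)
  moreover have "inj_on (\<lambda>k. doubled h L (i, j, k)) {..<2*h}" for i j
    using inj_on_doubled_line[of "\<lambda>k. L (i mod h, j mod h, k)" h "i div h + j div h"] L False
    by (auto simp: doubled_def latin_cube_def latin_cube_on_iff ac_simps simp del: even_add odd_add)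
  moreover have "doubled h L (i, j, k) < 2 * h" for i j k
    using valm[of i j k] by (simp add: doubled_def)
  ultimately show ?thesis
    by (simp add: latin_cube_def latin_cube_on_iff)
qed

text \<open>Block 000 is the new subcube of order \<open>h\<close>. The old subcubes reappear in
  block 111, with indices and symbols shifted by \<open>h\<close>.\<close>

lemma LC_Cons_if_LC:
  assumes LC: "LC ks L" and h: "sum_list ks = h"
  shows "LC (h # ks) (doubled h L)"
proof -
  have sum: "sum_list (h # ks) = 2 * h" using h by simp
  obtain I J K S where L: "latin_cube h L"
    and sub: "\<And>t. t < length ks \<Longrightarrow> subcube h L (ks ! t) (I t) (J t) (K t) (S t)"
    and disj: "\<And>s t. s < length ks \<Longrightarrow> t < length ks \<Longrightarrow> s \<noteq> t \<Longrightarrow>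
        I s \<inter> I t = {} \<and> J s \<inter> J t = {} \<and> K s \<inter> K t = {} \<and> S s \<inter> S t = {}"
    using LC unfolding LC_def h by metis
  \<comment> \<open>Position 0 is the prepended part \<open>h\<close>; the old parts move up by one
    position.\<close>
  define up where "up X t = (case t of 0 \<Rightarrow> {..<h} | Suc u \<Rightarrow> (+) h ` X u)"
    for X :: "nat \<Rightarrow> nat set" and t
  have sub0: "subcube (2 * h) (doubled h L) h {..<h} {..<h} {..<h} {..<h}"
  proof -
    have "latin_cube_on h {..<h} {..<h} {..<h} {..<h} L"
      using L by (simp add: latin_cube_def)
    then have "latin_cube_on h {..<h} {..<h} {..<h} {..<h} (doubled h L)"
      by (rule latin_cube_on_relabel[where a = id and b = id and c = id and s = id])
        (auto simp: doubled_def)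
    then show ?thesis by (auto simp: subcube_def)
  qed
  have subS: "subcube (2 * h) (doubled h L) (ks ! t) ((+) h ` I t) ((+) h ` J t)
      ((+) h ` K t) ((+) h ` S t)" if t: "t < length ks" for t
  proof -
    have lt: "I t \<subseteq> {..<h}" "J t \<subseteq> {..<h}" "K t \<subseteq> {..<h}" "S t \<subseteq> {..<h}"
      and cube: "latin_cube_on (ks ! t) (I t) (J t) (K t) (S t) L"
      using sub[OF t] by (auto simp: subcube_def)
    have down: "bij_betw (\<lambda>x. x - h) ((+) h ` X) X" for X
      by (auto simp: bij_betw_def inj_on_def image_image)
    have "bij_betw ((+) h) (S t) ((+) h ` S t)"
      by (simp add: bij_betw_def)
    then have "latin_cube_on (ks ! t) ((+) h ` I t) ((+) h ` J t) ((+) h ` K t) ((+) h ` S t)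
        (doubled h L)"
    proof (rule latin_cube_on_relabel[OF cube down down down])
      fix i j k
      assume "i \<in> (+) h ` I t" "j \<in> (+) h ` J t" "k \<in> (+) h ` K t"
      then obtain i' j' k' where "i = h + i'" "j = h + j'" "k = h + k'" "i' < h" "j' < h" "k' < h"
        using lt by blast
      \<comment> \<open>All three block numbers are 1, so their sum is odd and the symbol is raised
        by \<open>h\<close>.\<close>
      moreover have "(h + x) div h = 1" "(h + x) mod h = x" if "x < h" for x
        using that by (simp_all add: div_add_self1)
      ultimately show "doubled h L (i, j, k) = h + L (i - h, j - h, k - h)"
        by (simp add: doubled_def)
    qed
    then show ?thesis
      using lt by (auto simp: subcube_def)
  qed
  have "subcube (2 * h) (doubled h L) ((h # ks) ! t) (up I t) (up J t) (up K t) (up S t)"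
    if "t < length (h # ks)" for t
    using that sub0 subS by (cases t) (auto simp: up_def)
  \<comment> \<open>Shifted sets lie at or above \<open>h\<close>, hence miss \<open>{..<h}\<close>;
    between two of them, disjointness survives because the shift is injective.\<close>
  moreover have "up X u \<inter> up X t = {}"
    if "u \<noteq> t" "\<forall>u' t'. u = Suc u' \<longrightarrow> t = Suc t' \<longrightarrow> X u' \<inter> X t' = {}" for X u t
    using that by (cases u; cases t) (auto simp: up_def)
  then have "up I u \<inter> up I t = {} \<and> up J u \<inter> up J t = {} \<and> up K u \<inter> up K t = {} \<and>
      up S u \<inter> up S t = {}" if "u < length (h # ks)" "t < length (h # ks)" "u \<noteq> t" for u t
    using that disj by simp
  ultimately show ?thesis
    using latin_cube_doubled[OF L] unfolding sum[symmetric]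
    by (intro LCI[where I = "up I" and J = "up J" and K = "up K" and S = "up S"]) blast+
qed

theorem theorem12:
  fixes hs :: "nat list" and n N :: nat
  assumes "length hs = n" and "n \<ge> 2"
    and "sorted_wrt (\<ge>) hs"
    and "\<forall>h \<in> set hs. h > 0"
    and "N = sum_list hs"
    and "2 * hd hs = N"
  shows "(\<exists>L. LC hs L) \<longleftrightarrow> (\<exists>L. LC (tl hs) L)"
proof -
  obtain h ks where hs: "hs = h # ks"
    using assms by (cases hs) auto
  \<comment> \<open>From \<open>2 * h = N = h + sum_list ks\<close>.\<close>
  then have "sum_list ks = h"
    using assms by simp
  then show ?thesis
    unfolding hs list.sel using LC_tl_if_LC LC_Cons_if_LC by blast
qed

end
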